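(* Let $p$ be a prime and let $G=UT(4,p)$. Then the reduced commuting graph $\Gamma_{\mathrm{red}}(G)$ is not perfect.
   Context: For a prime $p$, $UT(4,p)$ is the group, under matrix multiplication, of all $4\times 4$ upper triangular matrices over the finite field $\mathbb{F}_p$ with all diagonal entries equal to $1$. For a finite non-abelian group $G$, the commuting graph $\Gamma(G)$ has vertex set $G$, two distinct vertices $x,y$ being adjacent if and only if $xy=yx$. The reduced commuting graph $\Gamma_{\mathrm{red}}(G)$ is obtained from $\Gamma(G)$ by deleting the vertices in the center $Z(G)$ of $G$ (i.e. it is the induced subgraph on $G\setminus Z(G)$). A graph is perfect if every induced subgraph $\Lambda$ satisfies $\chi(\Lambda)=\omega(\Lambda)$, where $\chi$ is the chromatic number and $\omega$ the clique number. *)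

theory Defs
  imports
    "HOL-Number_Theory.Residues"
    "Jordan_Normal_Form.Determinant"
    "Graph_Theory.Graph_Theory"
begin

section \<open>Unitriangular matrix groups\<close>

text \<open>
  The library's matrix product is tied to type-class arithmetic. Since the field with \<open>p\<close>
  elements is the ring record \<^const>\<open>residue_ring\<close>, the product is written out here with the
  operations of the record. Matrices are indexed from \<open>0\<close>.
\<close>

definition unitriangular_group :: "nat \<Rightarrow> ('a, 'b) ring_scheme \<Rightarrow> 'a mat monoid" where
  "unitriangular_group n R =
     \<lparr>carrier = {A \<in> carrier_mat n n.
        (\<forall>i<n. \<forall>j<n. A $$ (i, j) \<in> carrier R) \<and>
        (\<forall>i<n. A $$ (i, i) = \<one>\<^bsub>R\<^esub>) \<and>
        (\<forall>i<n. \<forall>j<i. A $$ (i, j) = \<zero>\<^bsub>R\<^esub>)},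
      monoid.mult = \<lambda>A B. mat n n (\<lambda>(i, j). \<Oplus>\<^bsub>R\<^esub>k\<in>{0..<n}. A $$ (i, k) \<otimes>\<^bsub>R\<^esub> B $$ (k, j)),
      one = mat n n (\<lambda>(i, j). if i = j then \<one>\<^bsub>R\<^esub> else \<zero>\<^bsub>R\<^esub>)\<rparr>"

definition UT :: "nat \<Rightarrow> nat \<Rightarrow> int mat monoid" where
  "UT n p = unitriangular_group n (residue_ring (int p))"


section \<open>Commuting graphs\<close>

text \<open>Simple graphs are represented, as in \<^locale>\<open>graph\<close>, by symmetric loop-free digraphs.\<close>

definition group_center :: "('a, 'b) monoid_scheme \<Rightarrow> 'a set" where
  "group_center G = {z \<in> carrier G. \<forall>x\<in>carrier G. z \<otimes>\<^bsub>G\<^esub> x = x \<otimes>\<^bsub>G\<^esub> z}"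

definition commuting_graph :: "('a, 'b) monoid_scheme \<Rightarrow> ('a, 'a \<times> 'a) pre_digraph" where
  "commuting_graph G = with_proj
     \<lparr>pverts = carrier G,
      parcs = {(x, y) \<in> carrier G \<times> carrier G. x \<noteq> y \<and> x \<otimes>\<^bsub>G\<^esub> y = y \<otimes>\<^bsub>G\<^esub> x}\<rparr>"

definition reduced_commuting_graph :: "('a, 'b) monoid_scheme \<Rightarrow> ('a, 'a \<times> 'a) pre_digraph" where
  "reduced_commuting_graph G = commuting_graph G \<restriction> (carrier G - group_center G)"


section \<open>Perfect graphs\<close>

text \<open>
  The following numbers are meaningful for finite loop-free graphs; in particular both are
  \<open>0\<close> for the graph without vertices, which is among the induced subgraphs of any graph.
\<close>

definition proper_colouring :: "('a, 'b) pre_digraph \<Rightarrow> nat \<Rightarrow> ('a \<Rightarrow> nat) \<Rightarrow> bool" where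
  "proper_colouring G k c \<longleftrightarrow>
     c ` verts G \<subseteq> {..<k} \<and> (\<forall>u v. u \<rightarrow>\<^bsub>G\<^esub> v \<longrightarrow> c u \<noteq> c v)"

definition chromatic_number :: "('a, 'b) pre_digraph \<Rightarrow> nat" where
  "chromatic_number G = (LEAST k. \<exists>c. proper_colouring G k c)"

definition clique :: "('a, 'b) pre_digraph \<Rightarrow> 'a set \<Rightarrow> bool" where
  "clique G K \<longleftrightarrow> K \<subseteq> verts G \<and> (\<forall>u\<in>K. \<forall>v\<in>K. u \<noteq> v \<longrightarrow> u \<rightarrow>\<^bsub>G\<^esub> v)"

definition clique_number :: "('a, 'b) pre_digraph \<Rightarrow> nat" where
  "clique_number G = Max (card ` {K. clique G K})"

definition perfect_graph :: "('a, 'b) pre_digraph \<Rightarrow> bool" where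
  "perfect_graph G \<longleftrightarrow> (\<forall>H. induced_subgraph H G \<longrightarrow> chromatic_number H = clique_number H)"


section \<open>Well-definedness\<close>

lemma graph_commuting_graph:
  assumes "finite (carrier G)"
  shows "graph (commuting_graph G)"
proof unfold_locales
  show "finite (arcs (commuting_graph G))"
    by (rule finite_subset[of _ "carrier G \<times> carrier G"])
       (use assms in \<open>auto simp: commuting_graph_def\<close>)
qed (use assms in \<open>auto simp: commuting_graph_def symmetric_def sym_def arc_to_ends_def\<close>)

lemma graph_reduced_commuting_graph:
  assumes "finite (carrier G)"
  shows "graph (reduced_commuting_graph G)"
proof -
  interpret graph "commuting_graph G"
    using graph_commuting_graph[OF assms] .
  have "induced_subgraph (reduced_commuting_graph G) (commuting_graph G)"
    unfolding reduced_commuting_graph_def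
    by (rule induced_induce) (auto simp: commuting_graph_def)
  then show ?thesis
    using digraphI_induced[THEN digraph.graphI] induced_graph_imp_symmetric[OF sym_arcs] by blast
qed

context
  fixes n p :: nat
  assumes p: "prime p"
begin

interpretation residues "int p" "residue_ring (int p)"
  using prime_gt_1_nat[OF p] by unfold_locales auto

lemma UT_carrier:
  "A \<in> carrier (UT n p) \<longleftrightarrow> A \<in> carrier_mat n n \<and>
     (\<forall>i<n. \<forall>j<n. 0 \<le> A $$ (i, j) \<and> A $$ (i, j) < int p) \<and>
     (\<forall>i<n. A $$ (i, i) = 1) \<and> (\<forall>i<n. \<forall>j<i. A $$ (i, j) = 0)"
  by (auto simp: UT_def unitriangular_group_def residue_ring_def)

lemma UT_mult:
  assumes "A \<in> carrier_mat n n" "B \<in> carrier_mat n n"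
  shows "A \<otimes>\<^bsub>UT n p\<^esub> B = map_mat (\<lambda>x. x mod int p) (A * B)"
proof (rule eq_matI)
  fix i j
  assume "i < dim_row (map_mat (\<lambda>x. x mod int p) (A * B))"
    "j < dim_col (map_mat (\<lambda>x. x mod int p) (A * B))"
  with assms have ij: "i < n" "j < n" by auto
  have "x \<otimes>\<^bsub>residue_ring (int p)\<^esub> y = (x * y) mod int p" for x y
    by (simp add: residue_ring_def)
  with ij assms show "(A \<otimes>\<^bsub>UT n p\<^esub> B) $$ (i, j) = map_mat (\<lambda>x. x mod int p) (A * B) $$ (i, j)"
    by (auto simp: UT_def unitriangular_group_def sum_cong scalar_prod_def)
qed (use assms in \<open>auto simp: UT_def unitriangular_group_def\<close>)

lemma UT_one: "\<one>\<^bsub>UT n p\<^esub> = 1\<^sub>m n"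
  by (auto simp: UT_def unitriangular_group_def residue_ring_def one_mat_def)

lemma mod_mat_mult:
  assumes "A \<in> carrier_mat n n" "B \<in> carrier_mat n n"
  shows "map_mat (\<lambda>x. x mod int p) (map_mat (\<lambda>x. x mod int p) A * B) =
           map_mat (\<lambda>x. x mod int p) (A * B)"
    and "map_mat (\<lambda>x. x mod int p) (A * map_mat (\<lambda>x. x mod int p) B) =
           map_mat (\<lambda>x. x mod int p) (A * B)"
proof -
  have *: "(\<Sum>k\<in>I. f k mod int p * g k) mod int p = (\<Sum>k\<in>I. f k * g k) mod int p"
    "(\<Sum>k\<in>I. f k * (g k mod int p)) mod int p = (\<Sum>k\<in>I. f k * g k) mod int p"
    for I :: "nat set" and f g
    by (subst (1 2) mod_sum_eq[symmetric], simp add: mod_mult_left_eq mod_mult_right_eq)+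
  show "map_mat (\<lambda>x. x mod int p) (map_mat (\<lambda>x. x mod int p) A * B) =
           map_mat (\<lambda>x. x mod int p) (A * B)"
    "map_mat (\<lambda>x. x mod int p) (A * map_mat (\<lambda>x. x mod int p) B) =
           map_mat (\<lambda>x. x mod int p) (A * B)"
    using assms by (auto intro!: eq_matI simp: scalar_prod_def *)
qed

lemma finite_UT: "finite (carrier (UT n p))"
proof (rule finite_subset)
  let ?F = "({0..<n} \<times> {0..<n}) \<rightarrow>\<^sub>E {0..<int p}"
  show "carrier (UT n p) \<subseteq> mat n n ` ?F"
  proof
    fix A assume A: "A \<in> carrier (UT n p)"
    then have "A = mat n n (restrict (($$) A) ({0..<n} \<times> {0..<n}))"
      by (auto simp: UT_carrier intro!: eq_matI)
    moreover have "restrict (($$) A) ({0..<n} \<times> {0..<n}) \<in> ?F"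
      using A by (auto simp: UT_carrier)
    ultimately show "A \<in> mat n n ` ?F" by blast
  qed
  show "finite (mat n n ` ?F)"
    by (intro finite_imageI finite_PiE) auto
qed

lemma UT_mult_closed:
  assumes A: "A \<in> carrier (UT n p)" and B: "B \<in> carrier (UT n p)"
  shows "A \<otimes>\<^bsub>UT n p\<^esub> B \<in> carrier (UT n p)"
proof -
  have "(\<Sum>k\<in>{0..<n}. A $$ (i, k) * B $$ (k, j)) = (if i = j then 1 else 0)"
    if "i < n" "j \<le> i" for i j
  proof -
    have "(\<Sum>k\<in>{0..<n}. A $$ (i, k) * B $$ (k, j)) =
          (\<Sum>k\<in>{0..<n}. if k = i then (if i = j then 1 else 0) else 0)"
    proof (rule sum.cong[OF refl])
      fix k assume k: "k \<in> {0..<n}"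
      consider "k < i" | "k = i" | "k > i" by linarith
      then show "A $$ (i, k) * B $$ (k, j) = (if k = i then (if i = j then 1 else 0) else 0)"
        by cases (use A B that k in \<open>auto simp: UT_carrier\<close>)
    qed
    then show ?thesis using that by (simp del: sum.delta' add: sum.delta)
  qed
  moreover have "A \<in> carrier_mat n n" "B \<in> carrier_mat n n"
    using A B by (auto simp: UT_carrier)
  moreover have "1 < int p" using prime_gt_1_nat[OF p] by simp
  ultimately show ?thesis
    by (auto simp: UT_carrier UT_mult scalar_prod_def)
qed

lemma group_UT: "group (UT n p)"
proof (rule groupI)
  let ?m = "map_mat (\<lambda>x. x mod int p)"
  have car: "A \<in> carrier_mat n n" and mod: "?m A = A" if "A \<in> carrier (UT n p)" for A
    using that by (auto simp: UT_carrier intro!: eq_matI)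
  show one: "\<one>\<^bsub>UT n p\<^esub> \<in> carrier (UT n p)"
    using prime_gt_1_nat[OF p] by (auto simp: UT_one UT_carrier)
  show "\<one>\<^bsub>UT n p\<^esub> \<otimes>\<^bsub>UT n p\<^esub> A = A" if "A \<in> carrier (UT n p)" for A
    using car[OF that] mod[OF that] by (simp add: UT_one UT_mult)
  show "A \<otimes>\<^bsub>UT n p\<^esub> B \<otimes>\<^bsub>UT n p\<^esub> C = A \<otimes>\<^bsub>UT n p\<^esub> (B \<otimes>\<^bsub>UT n p\<^esub> C)"
    if "A \<in> carrier (UT n p)" "B \<in> carrier (UT n p)" "C \<in> carrier (UT n p)" for A B C
    using that[THEN car] by (simp add: UT_mult mod_mat_mult assoc_mult_mat[of _ n n _ n _ n])
  show "\<exists>B\<in>carrier (UT n p). B \<otimes>\<^bsub>UT n p\<^esub> A = \<one>\<^bsub>UT n p\<^esub>" if A: "A \<in> carrier (UT n p)" for A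
  proof -
    note cA = car[OF A]
    have "diag_mat A = replicate n 1"
      using A by (intro nth_equalityI) (auto simp: diag_mat_def UT_carrier)
    moreover have "upper_triangular A"
      using A by (auto simp: UT_carrier)
    ultimately have "det A = 1"
      using det_upper_triangular[OF _ cA] by simp
    then have inv: "A * adj_mat A = 1\<^sub>m n" and cadj: "adj_mat A \<in> carrier_mat n n"
      using adj_mat[OF cA] cA by (auto intro!: eq_matI)
    have "inj_on (\<lambda>B. B \<otimes>\<^bsub>UT n p\<^esub> A) (carrier (UT n p))"
    proof (rule inj_on_inverseI)
      fix B assume B: "B \<in> carrier (UT n p)"
      note cB = car[OF B]
      have "?m ((B \<otimes>\<^bsub>UT n p\<^esub> A) * adj_mat A) = ?m (B * A * adj_mat A)"
        using cA cB cadj by (simp add: UT_mult mod_mat_mult)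
      also have "\<dots> = B"
        using cA cB cadj mod[OF B] by (simp add: assoc_mult_mat[of _ n n _ n _ n] inv)
      finally show "?m ((B \<otimes>\<^bsub>UT n p\<^esub> A) * adj_mat A) = B" .
    qed
    then have "(\<lambda>B. B \<otimes>\<^bsub>UT n p\<^esub> A) ` carrier (UT n p) = carrier (UT n p)"
      using A by (intro endo_inj_surj finite_UT) (auto intro: UT_mult_closed)
    with one show ?thesis by (metis (no_types, lifting) imageE)
  qed
qed (rule UT_mult_closed)

end

end

theory Submission
  imports Defs
begin

text \<open>
  A pentagon needs three colours but has no triangle, so a graph with an induced pentagon is not
  perfect. The commuting graph of \<open>UT 4 p\<close> has one for a reason of symplectic geometry. The
  unitriangular matrices with a \<open>0\<close> in the middle place of the superdiagonal form a subgroup. It is a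
  Heisenberg group of order \<open>p\<^sup>5\<close>: modulo the corner entry, its elements are the vectors
  \<open>(a, c, d, e)\<close> over the field with \<open>p\<close> elements, and two of them commute iff they are
  orthogonal for the symplectic form \<open>(a e' - a' e) + (d c' - d' c)\<close>
  (lemma \<open>heisenberg_mat_commute_iff\<close>).

  Hence it suffices to find five vectors, cyclically arranged, such that neighbours are orthogonal
  and all other pairs are not. In the basis \<open>a, c, d, e\<close> of unit vectors, which consists of the
  two hyperbolic pairs \<open>(a, e)\<close> and \<open>(d, c)\<close>, the cycle
  \<open>e, d, a, a + c, c + d + e\<close> has this property. The form takes only the values \<open>0\<close>, \<open>1\<close> and \<open>-1\<close>
  on it, so that a single choice serves all primes. No vertex is central, since each
  has a non-neighbour on the cycle.
\<close>

section \<open>Induced pentagons\<close>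

definition induced_pentagon :: "('a, 'b) pre_digraph \<Rightarrow> (nat \<Rightarrow> 'a) \<Rightarrow> bool" where
  "induced_pentagon G f \<longleftrightarrow> f ` {..<5} \<subseteq> verts G \<and> inj_on f {..<5} \<and>
     (\<forall>i<5. \<forall>j<5. f i \<rightarrow>\<^bsub>G\<^esub> f j \<longleftrightarrow> j = Suc i mod 5 \<or> i = Suc j mod 5)"

lemma less_5_cases:
  assumes "i < (5::nat)"
  obtains "i = 0" | "i = 1" | "i = 2" | "i = 3" | "i = 4"
  using assms by linarith

text \<open>
  A least number of colours is only attained if some number suffices, hence the finiteness;
  giving every vertex a colour of its own is then a proper colouring.
\<close>

lemma chromatic_number_witness:
  assumes "finite (verts G)" and loopfree: "\<And>v. \<not> v \<rightarrow>\<^bsub>G\<^esub> v" and "wf_digraph G"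
  shows "\<exists>c. proper_colouring G (chromatic_number G) c"
proof -
  interpret wf_digraph G by fact
  obtain c :: "'a \<Rightarrow> nat" and k where c: "c ` verts G = {..<k}" "inj_on c (verts G)"
    using finite_imp_inj_to_nat_seg[OF assms(1)] by (auto simp: lessThan_def)
  have "proper_colouring G k c"
    unfolding proper_colouring_def
    using c loopfree by (metis adj_in_verts(1,2) inj_onD order_refl)
  then show ?thesis
    unfolding chromatic_number_def by (intro LeastI_ex[of "\<lambda>k. \<exists>c. proper_colouring G k c"]) blast
qed

lemma induced_pentagon_not_perfect:
  assumes "graph G" and pent: "induced_pentagon G f"
  shows "\<not> perfect_graph G"
proof
  assume perfect: "perfect_graph G"
  interpret graph G by fact
  define H where "H = G \<restriction> f ` {..<5}"
  have V: "verts H = f ` {..<5}"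
    by (simp add: H_def)
  have E: "f i \<rightarrow>\<^bsub>H\<^esub> f j \<longleftrightarrow> j = Suc i mod 5 \<or> i = Suc j mod 5" if "i < 5" "j < 5" for i j
  proof -
    have "f i \<rightarrow>\<^bsub>H\<^esub> f j \<longleftrightarrow> f i \<rightarrow>\<^bsub>G\<^esub> f j"
      using that by (fastforce simp: H_def arcs_ends_conv image_iff)
    then show ?thesis
      using pent that by (simp add: induced_pentagon_def)
  qed
  have ind: "induced_subgraph H G"
    unfolding H_def using pent by (intro induced_induce) (simp add: induced_pentagon_def)
  then interpret H: digraph H
    by (rule digraphI_induced)
  have "card K \<le> 2" if K: "clique H K" for K
  proof (rule ccontr)
    assume "\<not> card K \<le> 2"
    then have "3 \<le> card K" by simp
    then obtain T where "T \<subseteq> K" "card T = 3"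
      by (rule obtain_subset_with_card_n)
    then obtain x y z where T: "x \<in> K" "y \<in> K" "z \<in> K" "x \<noteq> y" "x \<noteq> z" "y \<noteq> z"
      by (auto simp: card_3_iff)
    have "K \<subseteq> f ` {..<5}"
      using K by (simp add: clique_def V)
    with T(1-3) obtain i j k where less: "i < 5" "j < 5" "k < 5"
      and eq: "x = f i" "y = f j" "z = f k"
      by (meson imageE lessThan_iff subsetD)
    from T(4-6) have ne: "i \<noteq> j" "i \<noteq> k" "j \<noteq> k"
      unfolding eq by auto
    have "f i \<rightarrow>\<^bsub>H\<^esub> f j" "f i \<rightarrow>\<^bsub>H\<^esub> f k" "f j \<rightarrow>\<^bsub>H\<^esub> f k"
      using K T unfolding clique_def eq by simp_all
    with less have "j = Suc i mod 5 \<or> i = Suc j mod 5" "k = Suc i mod 5 \<or> i = Suc k mod 5"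
      "k = Suc j mod 5 \<or> j = Suc k mod 5"
      by (simp_all add: E)
    with less ne show False
      by (elim less_5_cases) simp_all
  qed
  moreover have "finite {K. clique H K}"
    by (rule finite_subset[of _ "Pow (verts H)"]) (auto simp: clique_def)
  moreover have "clique H {}"
    by (simp add: clique_def)
  ultimately have "clique_number H \<le> 2"
    unfolding clique_number_def by (intro Max.boundedI) auto
  with perfect ind have "chromatic_number H \<le> 2"
    by (simp add: perfect_graph_def)
  moreover obtain c where "proper_colouring H (chromatic_number H) c"
    using chromatic_number_witness[of H] H.wf_digraph_axioms H.adj_not_same by auto
  ultimately have c: "c (f i) < 2" "c (f i) \<noteq> c (f (Suc i mod 5))" if "i < 5" for i
    using that E[of i "Suc i mod 5"] by (fastforce simp: proper_colouring_def V)+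
  \<comment> \<open>Going once round the pentagon, the two colours would have to alternate five times.\<close>
  show False
    using c[of 0] c[of 1] c[of 2] c[of 3] c[of 4] by (simp add: numeral_2_eq_2)
qed

lemma reduced_commuting_graph_verts:
  "verts (reduced_commuting_graph G) = carrier G - group_center G"
  by (simp add: reduced_commuting_graph_def)

lemma reduced_commuting_graph_adj_iff:
  "x \<rightarrow>\<^bsub>reduced_commuting_graph G\<^esub> y \<longleftrightarrow>
     x \<in> carrier G - group_center G \<and> y \<in> carrier G - group_center G \<and>
     x \<noteq> y \<and> x \<otimes>\<^bsub>G\<^esub> y = y \<otimes>\<^bsub>G\<^esub> x"
  by (auto simp: reduced_commuting_graph_def commuting_graph_def arcs_ends_conv image_iff)

text \<open>
  The commutation pattern alone makes the five elements noncentral and distinct: every position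
  on the cycle has a non-neighbour, and any two positions are told apart by a third one that is
  a neighbour of only one of them.
\<close>

lemma reduced_commuting_graph_induced_pentagonI:
  fixes f :: "nat \<Rightarrow> 'a"
  assumes carrier: "\<And>i. i < 5 \<Longrightarrow> f i \<in> carrier G"
    and commute: "\<And>i j. i < 5 \<Longrightarrow> j < 5 \<Longrightarrow>
      f i \<otimes>\<^bsub>G\<^esub> f j = f j \<otimes>\<^bsub>G\<^esub> f i \<longleftrightarrow> i = j \<or> j = Suc i mod 5 \<or> i = Suc j mod 5"
  shows "induced_pentagon (reduced_commuting_graph G) f"
proof -
  have noncentral: "f i \<notin> group_center G" if "i < 5" for i
  proof -
    have "i \<noteq> (i + 2) mod 5" "(i + 2) mod 5 \<noteq> Suc i mod 5" "i \<noteq> Suc ((i + 2) mod 5) mod 5"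
      using that by (auto elim: less_5_cases)
    with that have "f i \<otimes>\<^bsub>G\<^esub> f ((i + 2) mod 5) \<noteq> f ((i + 2) mod 5) \<otimes>\<^bsub>G\<^esub> f i"
      by (simp add: commute)
    then show ?thesis
      using carrier[of "(i + 2) mod 5"] by (auto simp: group_center_def)
  qed
  have inj: "inj_on f {..<5}"
  proof (rule inj_onI)
    fix i j assume ij: "i \<in> {..<5}" "j \<in> {..<5}" "f i = f j"
    then have *: "i = k \<or> k = Suc i mod 5 \<or> i = Suc k mod 5 \<longleftrightarrow>
        j = k \<or> k = Suc j mod 5 \<or> j = Suc k mod 5" if "k < 5" for k
      using commute[of i k] commute[of j k] that by simp
    show "i = j"
      using ij(1,2) *[of 0] *[of 1] *[of 2] *[of 3] *[of 4]
      unfolding lessThan_iff by (elim less_5_cases) simp_all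
  qed
  have "f i \<rightarrow>\<^bsub>reduced_commuting_graph G\<^esub> f j \<longleftrightarrow> j = Suc i mod 5 \<or> i = Suc j mod 5"
    if "i < 5" "j < 5" for i j
  proof -
    have "f i = f j \<longleftrightarrow> i = j"
      using inj that by (auto simp: inj_on_def)
    moreover have "i \<noteq> j" if "j = Suc i mod 5 \<or> i = Suc j mod 5"
      using that \<open>i < 5\<close> by (auto elim: less_5_cases)
    ultimately show ?thesis
      using that by (auto simp: reduced_commuting_graph_adj_iff carrier noncentral commute)
  qed
  then show ?thesis
    using inj carrier noncentral by (auto simp: induced_pentagon_def reduced_commuting_graph_verts)
qed


section \<open>A Heisenberg subgroup\<close>

definition heisenberg_mat :: "int \<times> int \<times> int \<times> int \<Rightarrow> int mat" where
  "heisenberg_mat = (\<lambda>(a, c, d, e). mat_of_rows_list 4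
     [[1, a, d, 0],
      [0, 1, 0, e],
      [0, 0, 1, c],
      [0, 0, 0, 1]])"

lemma heisenberg_mat_carrier_mat: "heisenberg_mat v \<in> carrier_mat 4 4"
  by (cases v) (simp add: heisenberg_mat_def mat_of_rows_list_def numeral_eq_Suc)

lemma heisenberg_mat_in_UT:
  assumes "prime p" and "{a, c, d, e} \<subseteq> {0..<int p}"
  shows "heisenberg_mat (a, c, d, e) \<in> carrier (UT 4 p)"
  using assms(2) prime_gt_1_nat[OF assms(1)]
  unfolding UT_carrier[OF assms(1)]
  by (simp add: heisenberg_mat_carrier_mat)
    (simp add: All_less_Suc heisenberg_mat_def mat_of_rows_list_def numeral_eq_Suc)

text \<open>
  The two products agree outside the upper right corner, where they are \<open>a e' + d c'\<close>
  and \<open>a' e + d' c\<close>.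
\<close>

lemma heisenberg_mat_commute_iff:
  assumes "prime p"
  shows "heisenberg_mat (a, c, d, e) \<otimes>\<^bsub>UT 4 p\<^esub> heisenberg_mat (a', c', d', e') =
         heisenberg_mat (a', c', d', e') \<otimes>\<^bsub>UT 4 p\<^esub> heisenberg_mat (a, c, d, e) \<longleftrightarrow>
         [a * e' + d * c' = a' * e + d' * c] (mod int p)"
proof -
  have prod: "heisenberg_mat (a, c, d, e) * heisenberg_mat (a', c', d', e') =
      mat_of_rows_list 4
       [[1, a + a', d + d', a * e' + d * c'],
        [0, 1, 0, e + e'],
        [0, 0, 1, c + c'],
        [0, 0, 0, 1]]" for a c d e a' c' d' e'
    by (simp add: mat_eq_iff All_less_Suc heisenberg_mat_def mat_of_rows_list_def
        scalar_prod_def sum.atLeast0_lessThan_Suc numeral_eq_Suc)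
  show ?thesis
    unfolding UT_mult[OF assms heisenberg_mat_carrier_mat heisenberg_mat_carrier_mat] prod cong_def
    by (simp add: mat_eq_iff All_less_Suc mat_of_rows_list_def numeral_eq_Suc add.commute)
qed

text \<open>
  The cycle \<open>e, d, a, a + c, c + d + e\<close>, with coordinates in the order \<open>a, c, d, e\<close>. Only its fourth
  edge is not orthogonal at sight: there the contributions \<open>1\<close> of \<open>(a, e)\<close> and \<open>-1\<close> of \<open>(d, c)\<close>
  cancel.
\<close>

definition pentagon_vectors :: "(int \<times> int \<times> int \<times> int) list" where
  "pentagon_vectors = [(0,0,0,1), (0,0,1,0), (1,0,0,0), (1,1,0,0), (0,1,1,1)]"

theorem proposition6p1:
  fixes p :: nat
  assumes "prime p"
  shows "\<not> perfect_graph (reduced_commuting_graph (UT 4 p))"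
proof (rule induced_pentagon_not_perfect)
  let ?f = "\<lambda>i. heisenberg_mat (pentagon_vectors ! i)"
  have p: "1 < p"
    using assms by (rule prime_gt_1_nat)
  show "graph (reduced_commuting_graph (UT 4 p))"
    using finite_UT[OF assms] by (rule graph_reduced_commuting_graph)
  show "induced_pentagon (reduced_commuting_graph (UT 4 p)) ?f"
  proof (rule reduced_commuting_graph_induced_pentagonI)
    show "?f i \<in> carrier (UT 4 p)" if "i < 5" for i
      using that p by (auto simp: pentagon_vectors_def heisenberg_mat_in_UT[OF assms]
          elim: less_5_cases)
    show "?f i \<otimes>\<^bsub>UT 4 p\<^esub> ?f j = ?f j \<otimes>\<^bsub>UT 4 p\<^esub> ?f i \<longleftrightarrow>
        i = j \<or> j = Suc i mod 5 \<or> i = Suc j mod 5" if "i < 5" "j < 5" for i j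
      using that p
      by (elim less_5_cases)
        (simp_all add: pentagon_vectors_def heisenberg_mat_commute_iff[OF assms] cong_def)
  qed
qed

end
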